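(* Consider a family of optimization problems indexed by $l\in L$, $$J^{l*}=\min_{s\in S^l}J^l(s),$$ where for each $l\in L$ the decision space $S^l$ has bounded volume or finitely many elements, and $J^l:S^l\to\mathbb{R}$ is bounded. Fix $N_p$ and let $\Gamma(N_p)$ be the real-valued random variable, with distribution $\pi_G$, whose samples $\gamma$ are produced as follows: (1) uniformly sample an index $l\in L$; (2) sample $N_p$ decisions independently from the uniform distribution on $S^l$, and let $s^{l*}_{N_p}$ be a sampled decision of minimum sampled cost $J^l$ (the percentile solution); (3) report $\gamma=G^l(s^{l*}_{N_p})$, where $G^l(s)=J^l(s)-J^{l*}$ is the optimality gap. Let $\{\gamma_i\}_{i=1}^R$ be a set of $R$ independent samples of $\Gamma(N_p)$, with $\gamma^*_R=\max_{1\le i\le R}\gamma_i$. Then for all $\epsilon\in[0,1]$, percentile solutions to the problems of the family exhibit optimality gaps at most $\gamma^*_R$ with minimum probability $1-\epsilon$ and confidence $1-(1-\epsilon)^R$, i.e. $$\mathbb{P}^R_{\pi_G}\Bigl[\mathbb{P}_{\pi_G}[\gamma\le\gamma^*_R]\ge 1-\epsilon\Bigr]\ge 1-(1-\epsilon)^R.$$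
   Context: $N_p$ and $R$ are positive integers. It is assumed that indices can be sampled uniformly from $L$, that the minima $J^{l*}$ are attained, and that the procedure (1)-(3) defines a real-valued random variable $\Gamma(N_p)$. The outer probability $\mathbb{P}^R_{\pi_G}$ is the product probability over the $R$ independent samples $\gamma_1,\dots,\gamma_R$; the inner probability is over a fresh sample $\gamma\sim\pi_G$, with $\gamma^*_R$ fixed. *)

theory Defs
  imports "HOL-Probability.Probability"
begin

text \<open>
  A set \<open>A\<close> admits a uniform distribution if it is finite and nonempty, or if it has positive
  finite volume. The measure \<open>vol\<close> is the volume of the ambient space, e.g. \<^term>\<open>lborel\<close>, or
  \<^term>\<open>PiM {..<d} (\<lambda>_. lborel)\<close> when the dimension \<open>d\<close> has to vary within a family. On finite
  sets the uniform distribution is always the normalised counting measure and \<open>vol\<close> is ignored.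
\<close>

definition uniformly_samplable :: "'a measure \<Rightarrow> 'a set \<Rightarrow> bool" where
  "uniformly_samplable vol A \<longleftrightarrow>
     (finite A \<and> A \<noteq> {}) \<or> (A \<in> sets vol \<and> 0 < emeasure vol A \<and> emeasure vol A < \<infinity>)"

definition uniform_dist :: "'a measure \<Rightarrow> 'a set \<Rightarrow> 'a measure" where
  "uniform_dist vol A =
     (if finite A then uniform_count_measure A else uniform_measure (restrict_space vol A) A)"

definition attains_min :: "'s set \<Rightarrow> ('s \<Rightarrow> real) \<Rightarrow> bool" where
  "attains_min S J \<longleftrightarrow> (\<exists>s\<in>S. \<forall>t\<in>S. J s \<le> J t)"

definition optimality_gap :: "'s set \<Rightarrow> ('s \<Rightarrow> real) \<Rightarrow> 's \<Rightarrow> real" where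
  "optimality_gap S J s = J s - (INF t\<in>S. J t)"

text \<open>
  Ties between sampled decisions of minimal cost are broken by \<^const>\<open>arg_min_on\<close>; tied decisions
  have the same cost, hence the same optimality gap.
\<close>

definition percentile_solution :: "('s \<Rightarrow> real) \<Rightarrow> nat \<Rightarrow> (nat \<Rightarrow> 's) \<Rightarrow> 's" where
  "percentile_solution J N \<omega> = arg_min_on J (\<omega> ` {1..N})"

definition reported_gap :: "'s set \<Rightarrow> ('s \<Rightarrow> real) \<Rightarrow> nat \<Rightarrow> (nat \<Rightarrow> 's) \<Rightarrow> real" where
  "reported_gap S J N \<omega> = optimality_gap S J (percentile_solution J N \<omega>)"

definition decision_samples :: "'s measure \<Rightarrow> 's set \<Rightarrow> nat \<Rightarrow> (nat \<Rightarrow> 's) measure" where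
  "decision_samples vol S N = PiM {1..N} (\<lambda>_. uniform_dist vol S)"

text \<open>The conditional law of the reported gap given that the index \<open>l\<close> was sampled.\<close>

definition gap_kernel ::
  "('l \<Rightarrow> 's measure) \<Rightarrow> ('l \<Rightarrow> 's set) \<Rightarrow> ('l \<Rightarrow> 's \<Rightarrow> real) \<Rightarrow> nat \<Rightarrow> 'l \<Rightarrow> real measure" where
  "gap_kernel vol S J N l =
     distr (decision_samples (vol l) (S l) N) borel (reported_gap (S l) (J l) N)"

definition gap_dist ::
  "'l measure \<Rightarrow> 'l set \<Rightarrow> ('l \<Rightarrow> 's measure) \<Rightarrow> ('l \<Rightarrow> 's set) \<Rightarrow> ('l \<Rightarrow> 's \<Rightarrow> real) \<Rightarrow> nat \<Rightarrow> real measure"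
  where
  "gap_dist volL L vol S J N = uniform_dist volL L \<bind> gap_kernel vol S J N"

text \<open>
  The sampling procedure defines a real random variable: for each index the reported gap is a
  measurable function of the sampled decisions, and its law depends measurably on the index.
  Without these conditions \<^const>\<open>distr\<close> and \<^const>\<open>bind\<close> take unintended values.
\<close>

definition gap_is_random_variable ::
  "'l measure \<Rightarrow> 'l set \<Rightarrow> ('l \<Rightarrow> 's measure) \<Rightarrow> ('l \<Rightarrow> 's set) \<Rightarrow> ('l \<Rightarrow> 's \<Rightarrow> real) \<Rightarrow> nat \<Rightarrow> bool"
  where
  "gap_is_random_variable volL L vol S J N \<longleftrightarrow>
     (\<forall>l\<in>L. reported_gap (S l) (J l) N \<in> borel_measurable (decision_samples (vol l) (S l) N)) \<and>
     gap_kernel vol S J N \<in> measurable (uniform_dist volL L) (prob_algebra borel)"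

end

theory Submission
  imports Defs
begin

text \<open>
  Write \<open>F\<close> for the distribution function of the reported gap. The set \<open>B = {x. F x < 1 - \<epsilon>}\<close> is an
  initial segment of the line, and continuity of the measure from below gives it probability at
  most \<open>1 - \<epsilon>\<close>, whether or not \<open>F\<close> jumps at its endpoint. Since \<open>F\<close> is monotone, the outer event
  fails exactly if all \<open>R\<close> samples fall into \<open>B\<close>, which by independence has probability at most
  \<open>(1 - \<epsilon>) ^ R\<close>.
\<close>

lemma (in real_distribution) prob_cdf_less_le:
  assumes "0 \<le> c"
  shows "prob {x. cdf M x < c} \<le> c"
proof -
  define B where "B = {x. cdf M x < c}"
  have down: "y \<in> B" if "x \<in> B" "y \<le> x" for x y
    using that cdf_nondecreasing[of y x] by (auto simp: B_def)
  \<comment> \<open>As \<open>B\<close> is downward closed, these cases are: empty, the whole line,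
    a closed ray, an open ray.\<close>
  consider "B = {}" | "B \<noteq> {}" "\<not> bdd_above B" | "B \<noteq> {}" "bdd_above B" "Sup B \<in> B"
    | "B \<noteq> {}" "bdd_above B" "Sup B \<notin> B"
    by metis
  then have "prob B \<le> c"
  proof cases
    case 1
    then show ?thesis using assms by simp
  next
    case 2
    have "x \<in> B" for x
    proof -
      obtain y where "y \<in> B" "x < y"
        using 2 by (meson bdd_above.I not_le)
      then show ?thesis
        by (intro down[of y x]) auto
    qed
    then have "cdf M x \<le> c" for x
      by (simp add: B_def less_imp_le)
    \<comment> \<open>The distribution function tends to 1 at infinity, so its upper bound
      \<open>c\<close> is at least 1 and the claim is trivial.\<close>
    then have "1 \<le> c"
      by (intro tendsto_upperbound[OF cdf_lim_at_top_prob] always_eventually) auto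
    then show ?thesis
      using prob_le_1[of B] by linarith
  next
    case 3
    have "B = {..Sup B}"
      using down[OF 3(3)] cSup_upper[OF _ 3(2)] by blast
    then have "prob B = cdf M (Sup B)"
      unfolding cdf_def by metis
    then show ?thesis
      using 3 by (simp add: B_def)
  next
    case 4
    have B: "B = {..<Sup B}"
    proof (intro set_eqI iffI)
      fix x assume "x \<in> B"
      with 4 have "x \<le> Sup B" "x \<noteq> Sup B"
        by (auto intro: cSup_upper)
      then show "x \<in> {..<Sup B}" by simp
    next
      fix x assume "x \<in> {..<Sup B}"
      then obtain y where "y \<in> B" "x < y"
        using 4 less_cSup_iff[of B x] by auto
      then show "x \<in> B"
        by (intro down[of y x]) auto
    qed
    \<comment> \<open>The left limit of the distribution function at \<open>Sup B\<close> is the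
      probability of the open ray; this is where continuity from below enters.\<close>
    have "eventually (\<lambda>x. cdf M x \<le> c) (at_left (Sup B))"
    proof (unfold eventually_at_filter, intro always_eventually allI impI)
      fix x assume "x \<in> {..<Sup B}"
      then have "x \<in> B" using B by blast
      then show "cdf M x \<le> c" by (simp add: B_def)
    qed
    then have "prob {..<Sup B} \<le> c"
      by (intro tendsto_upperbound[OF cdf_at_left]) auto
    then show ?thesis using B by metis
  qed
  then show ?thesis by (simp add: B_def)
qed

lemma prob_product_cdf_Max_ge:
  fixes M :: "real measure" and \<epsilon> :: real
  assumes "real_distribution M" and "finite I" "I \<noteq> {}" and "\<epsilon> \<le> 1"
  shows "\<P>(\<gamma> in PiM I (\<lambda>_. M). cdf M (Max (\<gamma> ` I)) \<ge> 1 - \<epsilon>) \<ge> 1 - (1 - \<epsilon>) ^ card I"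
proof -
  interpret M: real_distribution M by fact
  interpret P: finite_product_prob_space "\<lambda>_. M" I
    by unfold_locales fact
  define B where "B = {x. cdf M x < 1 - \<epsilon>}"
  \<comment> \<open>Monotonicity alone gives measurability, so jumps do no harm and \<open>B\<close>
    is an event.\<close>
  have "cdf M \<in> borel_measurable borel"
    by (intro borel_measurable_mono monoI M.cdf_nondecreasing)
  then have B: "B \<in> sets M"
    unfolding B_def M.events_eq_borel by measurable
  have sets: "PiE I (\<lambda>_. B) \<in> sets (PiM I (\<lambda>_. M))"
    using B assms by (intro sets_PiM_I_finite) auto
  \<comment> \<open>The maximum is one of the samples, and by monotonicity it lies outside
    \<open>B\<close> as soon as any sample does.\<close>
  have iff: "cdf M (Max (\<gamma> ` I)) \<ge> 1 - \<epsilon> \<longleftrightarrow> (\<exists>i\<in>I. \<gamma> i \<notin> B)" for \<gamma>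
  proof
    assume *: "cdf M (Max (\<gamma> ` I)) \<ge> 1 - \<epsilon>"
    have "Max (\<gamma> ` I) \<in> \<gamma> ` I"
      using assms by (intro Max_in) auto
    with * show "\<exists>i\<in>I. \<gamma> i \<notin> B"
      by (force simp: B_def)
  next
    assume "\<exists>i\<in>I. \<gamma> i \<notin> B"
    then obtain i where i: "i \<in> I" "\<gamma> i \<notin> B" by blast
    then have "\<gamma> i \<le> Max (\<gamma> ` I)"
      using assms by (intro Max_ge) auto
    with i M.cdf_nondecreasing[OF this] show "cdf M (Max (\<gamma> ` I)) \<ge> 1 - \<epsilon>"
      by (auto simp: B_def)
  qed
  have "{\<gamma> \<in> space (PiM I (\<lambda>_. M)). cdf M (Max (\<gamma> ` I)) \<ge> 1 - \<epsilon>}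
      = space (PiM I (\<lambda>_. M)) - PiE I (\<lambda>_. B)"
    by (simp add: iff space_PiM PiE_iff set_eq_iff) blast
  moreover have "P.prob (PiE I (\<lambda>_. B)) = M.prob B ^ card I"
    using B P.prob_times[of "\<lambda>_. B"] by simp
  moreover have "M.prob B ^ card I \<le> (1 - \<epsilon>) ^ card I"
    unfolding B_def using assms by (intro power_mono M.prob_cdf_less_le) auto
  ultimately show ?thesis
    using P.prob_compl[OF sets] by simp
qed

lemma prob_space_uniform_dist:
  assumes "uniformly_samplable vol A"
  shows "prob_space (uniform_dist vol A)"
proof (cases "finite A")
  case True
  with assms have "A \<noteq> {}"
    by (auto simp: uniformly_samplable_def)
  with True show ?thesis
    by (simp add: uniform_dist_def prob_space_uniform_count_measure)
next
  case False
  with assms have A: "A \<in> sets vol" "0 < emeasure vol A" "emeasure vol A < \<infinity>"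
    by (auto simp: uniformly_samplable_def)
  have "emeasure (restrict_space vol A) A = emeasure vol A"
    using A by (intro emeasure_restrict_space) (auto simp: sets.Int_space_eq2)
  with A False show ?thesis
    by (auto simp: uniform_dist_def intro!: prob_space_uniform_measure)
qed

text \<open>The kernel takes values in the probability measures on the Borel line, and mixing these
  over a random index yields another such measure.\<close>

lemma real_distribution_gap_dist:
  assumes "uniformly_samplable volL L" and "gap_is_random_variable volL L vol S J N"
  shows "real_distribution (gap_dist volL L vol S J N)"
proof -
  \<comment> \<open>The rules for \<open>bind\<close> used below expect the index law as a point of
    a \<open>prob_algebra\<close>; the one over its own sigma-algebra serves.\<close>
  have L: "uniform_dist volL L \<in> space (prob_algebra (uniform_dist volL L))"
    using prob_space_uniform_dist[OF assms(1)] by (simp add: space_prob_algebra)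
  have K: "gap_kernel vol S J N \<in> measurable (uniform_dist volL L) (prob_algebra borel)"
    using assms(2) by (simp add: gap_is_random_variable_def)
  show ?thesis
    using prob_space_bind'[OF L K] sets_bind'[OF L K]
    by (auto simp: gap_dist_def real_distribution_def real_distribution_axioms_def)
qed

theorem theorem4:
  fixes volL :: "'l measure" and L :: "'l set"
    and vol :: "'l \<Rightarrow> 's measure" and S :: "'l \<Rightarrow> 's set" and J :: "'l \<Rightarrow> 's \<Rightarrow> real"
    and N R :: nat and \<epsilon> :: real
  assumes "uniformly_samplable volL L"
    and "\<And>l. l \<in> L \<Longrightarrow> uniformly_samplable (vol l) (S l)"
    and "\<And>l. l \<in> L \<Longrightarrow> bounded (J l ` S l)"
    and "\<And>l. l \<in> L \<Longrightarrow> attains_min (S l) (J l)"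
    and "0 < N" and "0 < R"
    and "gap_is_random_variable volL L vol S J N"
    and "0 \<le> \<epsilon>" and "\<epsilon> \<le> 1"
  shows "\<P>(\<gamma> in PiM {1..R} (\<lambda>_. gap_dist volL L vol S J N).
           \<P>(g in gap_dist volL L vol S J N. g \<le> Max (\<gamma> ` {1..R})) \<ge> 1 - \<epsilon>)
         \<ge> 1 - (1 - \<epsilon>) ^ R"
proof -
  interpret real_distribution "gap_dist volL L vol S J N"
    using assms(1,7) by (rule real_distribution_gap_dist)
  \<comment> \<open>The inner probability, with the observed maximum held fixed as \<open>x\<close>,
    is the distribution function at \<open>x\<close>.\<close>
  have "\<P>(g in gap_dist volL L vol S J N. g \<le> x) = cdf (gap_dist volL L vol S J N) x" for x
    by (auto simp: cdf_def intro!: arg_cong[where f = prob])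
  then show ?thesis
    using prob_product_cdf_Max_ge[OF real_distribution_axioms, of "{1..R}" \<epsilon>] assms(6,9) by simp
qed

end
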